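(* Every Heisenberg odometer is of one of the following types: (1) pure product; (2) $(x,y)$-product and not flat; (3) flat and not $(x,y)$-product; (4) neither flat nor $(x,y)$-product. Furthermore, there exist Heisenberg odometers of each of these four types.
   Context: $H$ is the discrete Heisenberg group: the set $\mathbb Z^3$ with multiplication $(x,y,z)(x',y',z')=(x+x',y+y',z+z'+xy')$. Let $f:\mathbb Z\to H$, $f(z)=(0,0,z)$, and $g:H\to\mathbb Z^2$, $g(x,y,z)=(x,y)$. Odometers: given a decreasing sequence $\Gamma_1\supset\Gamma_2\supset\cdots$ of finite index normal subgroups of $H$ with $\bigcap_n\Gamma_n=\{e\}$, let $\overleftarrow{H/\Gamma_n}$ be the inverse limit of the quotients $H/\Gamma_n$ under the natural maps $\pi_n:H/\Gamma_{n+1}\to H/\Gamma_n$, with the inverse limit topology and Haar probability measure. The action of $H$ on $\overleftarrow{H/\Gamma_n}$ by left multiplication is called the $H$ odometer (or Heisenberg odometer) on $\overleftarrow{H/\Gamma_n}$. Two odometers are conjugate if there is an $H$-equivariant homeomorphism between them. For a finite index subgroup $\Gamma$ of $H$, let $i_\Gamma:g(\Gamma)\to\mathbb Z$, $i_\Gamma(x,y)=\min\{z\ge0:(x,y,z)\in\Gamma\}$. The subgroup $\Gamma$ is called flat if $i_\Gamma\equiv0$; $(x,y)$-product if there is a diagonal nonsingular matrix $A\in M(2,\mathbb Z)$ with $g(\Gamma)=A\mathbb Z^2$; and pure product if it is both flat and $(x,y)$-product. A Heisenberg odometer on $\overleftarrow{H/\Gamma_n}$ is called flat (respectively $(x,y)$-product,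 pure product) if it is conjugate to an $H$ odometer on some $\overleftarrow{H/\Gamma'_n}$ in which each normal subgroup $\Gamma'_n$ is flat (respectively $(x,y)$-product, pure product). *)

theory Defs
  imports "HOL-Algebra.Coset" "HOL-Analysis.Function_Topology" "HOL-Analysis.Determinants"
begin

definition heis :: "(int \<times> int \<times> int) monoid" where
  "heis = \<lparr>carrier = UNIV,
     monoid.mult = (\<lambda>(x, y, z) (x', y', z'). (x + x', y + y', z + z' + x * y')),
     one = (0, 0, 0)\<rparr>"

lemma group_heis: "group heis"
proof (rule groupI)
  fix a assume "a \<in> carrier heis"
  obtain x y z where "a = (x, y, z)" by (cases a)
  then have "(- x, - y, x * y - z) \<otimes>\<^bsub>heis\<^esub> a = \<one>\<^bsub>heis\<^esub>"
    by (simp add: heis_def)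
  moreover have "(- x, - y, x * y - z) \<in> carrier heis"
    by (simp add: heis_def)
  ultimately show "\<exists>b\<in>carrier heis. b \<otimes>\<^bsub>heis\<^esub> a = \<one>\<^bsub>heis\<^esub>"
    by (rule bexI)
qed (auto simp: heis_def algebra_simps)

definition heis_proj :: "int \<times> int \<times> int \<Rightarrow> int ^ 2" where
  "heis_proj = (\<lambda>(x, y, z). vector [x, y])"

text \<open>The function \<open>i\<^sub>\<Gamma>\<close>, meaningful only on \<open>heis_proj ` \<Gamma>\<close> for \<open>\<Gamma>\<close> of finite index:
  there the minimum is taken over a nonempty set, since \<open>\<Gamma>\<close> contains some \<open>(0, 0, k)\<close> with
  \<open>k > 0\<close>.\<close>

definition min_height :: "(int \<times> int \<times> int) set \<Rightarrow> int ^ 2 \<Rightarrow> int" where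
  "min_height \<Gamma> v = (LEAST z. 0 \<le> z \<and> (v $ 1, v $ 2, z) \<in> \<Gamma>)"

definition flat_subgroup :: "(int \<times> int \<times> int) set \<Rightarrow> bool" where
  "flat_subgroup \<Gamma> \<longleftrightarrow> (\<forall>v \<in> heis_proj ` \<Gamma>. min_height \<Gamma> v = 0)"

text \<open>Nonsingular means nonzero determinant; \<open>invertible A\<close> would ask for an inverse over
  the integers.\<close>

definition xy_product_subgroup :: "(int \<times> int \<times> int) set \<Rightarrow> bool" where
  "xy_product_subgroup \<Gamma> \<longleftrightarrow>
     (\<exists>A :: int ^ 2 ^ 2. (\<forall>i j. i \<noteq> j \<longrightarrow> A $ i $ j = 0) \<and> det A \<noteq> 0 \<and>
        heis_proj ` \<Gamma> = range (\<lambda>v. A *v v))"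

definition pure_product_subgroup :: "(int \<times> int \<times> int) set \<Rightarrow> bool" where
  "pure_product_subgroup \<Gamma> \<longleftrightarrow> flat_subgroup \<Gamma> \<and> xy_product_subgroup \<Gamma>"

text \<open>An odometer is represented by the sequence of subgroups defining it. The inclusions need
  not be strict. Its Haar probability measure is determined by these data and plays no part in
  conjugacy, which is topological, so it is not represented.\<close>

definition heis_odometer :: "(nat \<Rightarrow> (int \<times> int \<times> int) set) \<Rightarrow> bool" where
  "heis_odometer \<Gamma> \<longleftrightarrow>
     (\<forall>n. \<Gamma> n \<lhd> heis \<and> finite (carrier (heis Mod \<Gamma> n))) \<and>
     decseq \<Gamma> \<and> (\<Inter>n. \<Gamma> n) = {\<one>\<^bsub>heis\<^esub>}"

text \<open>The natural map from \<open>heis Mod \<Gamma> (Suc n)\<close> to \<open>heis Mod \<Gamma> n\<close> sends the coset of \<open>h\<close> to the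
  coset of \<open>h\<close>; on a coset \<open>C\<close>, regarded as a set, it is \<open>C \<mapsto> \<Gamma> n <#> C\<close>.\<close>

definition inv_limit :: "(nat \<Rightarrow> (int \<times> int \<times> int) set) \<Rightarrow> (nat \<Rightarrow> (int \<times> int \<times> int) set) set" where
  "inv_limit \<Gamma> = {c. \<forall>n. c n \<in> carrier (heis Mod \<Gamma> n) \<and> \<Gamma> n <#>\<^bsub>heis\<^esub> c (Suc n) = c n}"

definition inv_limit_topology ::
    "(nat \<Rightarrow> (int \<times> int \<times> int) set) \<Rightarrow> (nat \<Rightarrow> (int \<times> int \<times> int) set) topology" where
  "inv_limit_topology \<Gamma> =
     subtopology (product_topology (\<lambda>n. discrete_topology (carrier (heis Mod \<Gamma> n))) UNIV)
       (inv_limit \<Gamma>)"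

definition odometer_action ::
    "(nat \<Rightarrow> (int \<times> int \<times> int) set) \<Rightarrow> int \<times> int \<times> int \<Rightarrow>
     (nat \<Rightarrow> (int \<times> int \<times> int) set) \<Rightarrow> (nat \<Rightarrow> (int \<times> int \<times> int) set)" where
  "odometer_action \<Gamma> h c = (\<lambda>n. (\<Gamma> n #>\<^bsub>heis\<^esub> h) \<otimes>\<^bsub>heis Mod \<Gamma> n\<^esub> c n)"

definition conjugate_odometers ::
    "(nat \<Rightarrow> (int \<times> int \<times> int) set) \<Rightarrow> (nat \<Rightarrow> (int \<times> int \<times> int) set) \<Rightarrow> bool" where
  "conjugate_odometers \<Gamma> \<Gamma>' \<longleftrightarrow>
     (\<exists>\<phi>. homeomorphic_map (inv_limit_topology \<Gamma>) (inv_limit_topology \<Gamma>') \<phi> \<and>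
        (\<forall>h \<in> carrier heis. \<forall>c \<in> inv_limit \<Gamma>.
           \<phi> (odometer_action \<Gamma> h c) = odometer_action \<Gamma>' h (\<phi> c)))"

definition flat_odometer :: "(nat \<Rightarrow> (int \<times> int \<times> int) set) \<Rightarrow> bool" where
  "flat_odometer \<Gamma> \<longleftrightarrow>
     (\<exists>\<Gamma>'. heis_odometer \<Gamma>' \<and> conjugate_odometers \<Gamma> \<Gamma>' \<and> (\<forall>n. flat_subgroup (\<Gamma>' n)))"

definition xy_product_odometer :: "(nat \<Rightarrow> (int \<times> int \<times> int) set) \<Rightarrow> bool" where
  "xy_product_odometer \<Gamma> \<longleftrightarrow>
     (\<exists>\<Gamma>'. heis_odometer \<Gamma>' \<and> conjugate_odometers \<Gamma> \<Gamma>' \<and> (\<forall>n. xy_product_subgroup (\<Gamma>' n)))"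

definition pure_product_odometer :: "(nat \<Rightarrow> (int \<times> int \<times> int) set) \<Rightarrow> bool" where
  "pure_product_odometer \<Gamma> \<longleftrightarrow>
     (\<exists>\<Gamma>'. heis_odometer \<Gamma>' \<and> conjugate_odometers \<Gamma> \<Gamma>' \<and> (\<forall>n. pure_product_subgroup (\<Gamma>' n)))"

end

theory Submission imports Defs
begin

text \<open>Everything rests on one criterion (\<open>conjugate_iff_refines\<close>): two odometers are conjugate if
  and only if their defining sequences are cofinal in each other, every term of either sequence
  containing a term of the other. Cofinality lets one project each inverse limit onto the other
  coordinate by coordinate, and these projections are mutually inverse. Conversely, an equivariant
  continuous map can only lose information: the group elements that fix many coordinates of the
  base point must fix a given coordinate of its image.

  For the four cases to cover all odometers, an odometer that is both flat and \<open>(x, y)\<close>-product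
  must be pure product. Here one has a flat sequence \<open>F\<close> and a product sequence \<open>P\<close>, cofinal in
  each other. Whenever \<open>P m \<subseteq> F n\<close>, the set of \<open>(x, y, z)\<close> with \<open>(x, y)\<close> in the projection of \<open>P m\<close>
  and \<open>(0, 0, z) \<in> F n\<close> is a normal subgroup between \<open>P m\<close> and \<open>F n\<close> and is pure product. It is
  normal because commutators with elements of \<open>F n\<close> lie in \<open>F n\<close>. These subgroups interleave with
  both sequences, so they define a conjugate odometer.

  The examples are sequences \<open>K \<inter> heis_cube (3 ^ n)\<close> with \<open>K\<close> given by congruences modulo \<open>2\<close> or
  \<open>4\<close>. Tying \<open>z\<close> to \<open>x\<close> destroys flatness, tying \<open>y\<close> to \<open>x\<close> destroys the product form, and the
  four types arise from imposing neither, one or both of these. By the criterion, a flat (or product)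
  odometer conjugate to such a sequence would have a term squeezed between some
  \<open>K \<inter> heis_cube (3 ^ m)\<close> and \<open>K\<close>. Flatness (or the product form) of that term, applied
  to a suitable element of the smaller set, then yields an element outside \<open>K\<close>.\<close>

section \<open>Cosets of nested subgroups\<close>

interpretation heis: group heis
  by (rule group_heis)

lemma carrier_heis [simp]: "carrier heis = UNIV"
  by (simp add: heis_def)

lemma mult_heis [simp]: "(x, y, z) \<otimes>\<^bsub>heis\<^esub> (x', y', z') = (x + x', y + y', z + z' + x * y')"
  by (simp add: heis_def)

lemma one_heis [simp]: "\<one>\<^bsub>heis\<^esub> = (0, 0, 0)"
  by (simp add: heis_def)

lemma inv_heis [simp]: "inv\<^bsub>heis\<^esub> (x, y, z) = (- x, - y, x * y - z)"
  by (rule heis.inv_equality) auto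

lemma (in group) set_mult_r_coset_absorb:
  assumes H: "subgroup H G" and K: "subgroup K G" and "K \<subseteq> H" and x: "x \<in> carrier G"
  shows "H <#> (K #> x) = H #> x"
proof -
  have "H <#> K = H"
  proof
    show "H <#> K \<subseteq> H"
      using assms subgroup.m_closed[OF H] by (auto simp: set_mult_def)
    show "H \<subseteq> H <#> K"
      using subgroup.one_closed[OF K] subgroup.mem_carrier[OF H]
      by (force simp: set_mult_def)
  qed
  then show ?thesis
    using setmult_rcos_assoc[of H K x] x subgroup.subset[OF H] subgroup.subset[OF K] by simp
qed

text \<open>Absorption sends the cosets of the smaller subgroup onto those of the larger one.\<close>

lemma (in group) finite_FactGroup_mono:
  assumes H: "subgroup H G" and K: "subgroup K G" and "K \<subseteq> H"
    and fin: "finite (carrier (G Mod K))"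
  shows "finite (carrier (G Mod H))"
proof -
  have "carrier (G Mod H) \<subseteq> (\<lambda>C. H <#> C) ` carrier (G Mod K)"
  proof
    fix C assume "C \<in> carrier (G Mod H)"
    then obtain x where x: "x \<in> carrier G" "C = H #> x"
      by (auto simp: carrier_FactGroup)
    then have "C = H <#> (K #> x)"
      using set_mult_r_coset_absorb[OF H K \<open>K \<subseteq> H\<close>] by simp
    then show "C \<in> (\<lambda>C. H <#> C) ` carrier (G Mod K)"
      using x by (auto simp: carrier_FactGroup)
  qed
  then show ?thesis
    using fin finite_surj by blast
qed

lemma (in group) r_coset_eq_iff_mem:
  assumes "subgroup H G" "x \<in> carrier G"
  shows "H #> x = H \<longleftrightarrow> x \<in> H"
  using coset_join1[of H x] coset_join2[of x H] assms by (auto simp: subgroup.subset)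

section \<open>Conjugacy of odometers as cofinality\<close>

definition seq_refines :: "(nat \<Rightarrow> 'a set) \<Rightarrow> (nat \<Rightarrow> 'a set) \<Rightarrow> bool" where
  "seq_refines \<Gamma> \<Gamma>' \<longleftrightarrow> (\<forall>n. \<exists>m. \<Gamma> m \<subseteq> \<Gamma>' n)"

lemma seq_refines_refl: "seq_refines \<Gamma> \<Gamma>"
  by (auto simp: seq_refines_def)

lemma seq_refines_trans: "seq_refines \<Gamma> \<Gamma>' \<Longrightarrow> seq_refines \<Gamma>' \<Gamma>'' \<Longrightarrow> seq_refines \<Gamma> \<Gamma>''"
  unfolding seq_refines_def by (meson subset_trans)

text \<open>Monotone indices make the induced maps compatible with the bonding maps of the inverse
  limits, and \<open>n \<le> M n\<close> makes going there and back lead to a coordinate beyond \<open>n\<close>.\<close>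

lemma seq_refines_mono_index:
  assumes "seq_refines \<Gamma> \<Gamma>'" and "decseq \<Gamma>"
  obtains M where "mono M" and "\<And>n. n \<le> M n" and "\<And>n. \<Gamma> (M n) \<subseteq> \<Gamma>' n"
proof -
  obtain m where m: "\<And>n. \<Gamma> (m n) \<subseteq> \<Gamma>' n"
    using assms(1) unfolding seq_refines_def by metis
  define M where "M = (\<lambda>n. n + (\<Sum>i\<le>n. m i))"
  show thesis
  proof
    show "mono M"
      unfolding M_def by (intro monoI add_mono sum_mono2) auto
    show "n \<le> M n" for n
      by (simp add: M_def)
    show "\<Gamma> (M n) \<subseteq> \<Gamma>' n" for n
    proof -
      have "m n \<le> (\<Sum>i\<le>n. m i)"
        by (rule member_le_sum) auto
      then have "m n \<le> M n"
        by (simp add: M_def)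
      then show ?thesis
        using decseqD[OF assms(2)] m by blast
    qed
  qed
qed

context
  fixes \<Gamma> :: "nat \<Rightarrow> (int \<times> int \<times> int) set"
  assumes odo: "heis_odometer \<Gamma>"
begin

lemma odometer_normal: "\<Gamma> n \<lhd> heis"
  using odo by (simp add: heis_odometer_def)

lemma odometer_subgroup: "subgroup (\<Gamma> n) heis"
  using odometer_normal by (rule normal_imp_subgroup)

lemma odometer_decseq: "decseq \<Gamma>"
  using odo by (simp add: heis_odometer_def)

lemma odometer_finite: "finite (carrier (heis Mod \<Gamma> n))"
  using odo by (simp add: heis_odometer_def)

lemma odometer_absorb:
  "m \<le> n \<Longrightarrow> \<Gamma> m <#>\<^bsub>heis\<^esub> (\<Gamma> n #>\<^bsub>heis\<^esub> h) = \<Gamma> m #>\<^bsub>heis\<^esub> h"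
  using decseqD[OF odometer_decseq]
  by (intro heis.set_mult_r_coset_absorb odometer_subgroup) auto

text \<open>Finitely many coordinates of a point of the inverse limit are determined by the last of
  them, so they are simultaneously the cosets of a single group element.\<close>

lemma inv_limit_coset:
  assumes c: "c \<in> inv_limit \<Gamma>"
  obtains h where "\<And>j. j \<le> k \<Longrightarrow> c j = \<Gamma> j #>\<^bsub>heis\<^esub> h"
proof -
  have "c k \<in> carrier (heis Mod \<Gamma> k)"
    using c by (simp add: inv_limit_def)
  then obtain h where h: "c k = \<Gamma> k #>\<^bsub>heis\<^esub> h"
    unfolding carrier_FactGroup by blast
  have "c j = \<Gamma> j #>\<^bsub>heis\<^esub> h" if "j \<le> k" for j
    using that
  proof (induction rule: inc_induct)
    case base
    show ?case by (fact h)
  next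
    case (step i)
    have "c i = \<Gamma> i <#>\<^bsub>heis\<^esub> c (Suc i)"
      using c by (simp add: inv_limit_def)
    then show ?case
      using step.IH odometer_absorb[of i "Suc i"] by simp
  qed
  then show thesis by (rule that)
qed

lemma inv_limit_self: "\<Gamma> \<in> inv_limit \<Gamma>"
proof -
  have "\<Gamma> n #>\<^bsub>heis\<^esub> \<one>\<^bsub>heis\<^esub> = \<Gamma> n" for n
    by (rule heis.coset_mult_one) simp
  moreover have "\<Gamma> n <#>\<^bsub>heis\<^esub> (\<Gamma> (Suc n) #>\<^bsub>heis\<^esub> \<one>\<^bsub>heis\<^esub>) = \<Gamma> n #>\<^bsub>heis\<^esub> \<one>\<^bsub>heis\<^esub>" for n
    by (rule odometer_absorb) simp
  ultimately show ?thesis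
    by (auto simp: inv_limit_def carrier_FactGroup intro!: image_eqI)
qed

lemma odometer_action_coset:
  "c n = \<Gamma> n #>\<^bsub>heis\<^esub> g \<Longrightarrow>
     odometer_action \<Gamma> h c n = \<Gamma> n #>\<^bsub>heis\<^esub> (h \<otimes>\<^bsub>heis\<^esub> g)"
  by (simp add: odometer_action_def normal.rcos_sum[OF odometer_normal])

lemma odometer_action_inv_limit:
  assumes "c \<in> inv_limit \<Gamma>"
  shows "odometer_action \<Gamma> h c \<in> inv_limit \<Gamma>"
proof -
  have "odometer_action \<Gamma> h c n \<in> carrier (heis Mod \<Gamma> n) \<and>
        \<Gamma> n <#>\<^bsub>heis\<^esub> odometer_action \<Gamma> h c (Suc n) = odometer_action \<Gamma> h c n" for n
  proof -
    obtain g where "\<And>j. j \<le> Suc n \<Longrightarrow> c j = \<Gamma> j #>\<^bsub>heis\<^esub> g"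
      using inv_limit_coset[OF assms] by blast
    then have "odometer_action \<Gamma> h c j = \<Gamma> j #>\<^bsub>heis\<^esub> (h \<otimes>\<^bsub>heis\<^esub> g)" if "j \<le> Suc n" for j
      using that by (simp add: odometer_action_coset)
    then show ?thesis
      by (simp add: odometer_absorb carrier_FactGroup)
  qed
  then show ?thesis
    by (simp add: inv_limit_def)
qed

lemma topspace_inv_limit: "topspace (inv_limit_topology \<Gamma>) = inv_limit \<Gamma>"
  by (auto simp: inv_limit_topology_def inv_limit_def)

end

text \<open>The map between inverse limits induced by the projections
  \<open>heis Mod \<Gamma> (M n) \<rightarrow> heis Mod \<Gamma>' n\<close>.\<close>

definition transfer ::
    "(nat \<Rightarrow> (int \<times> int \<times> int) set) \<Rightarrow> (nat \<Rightarrow> nat) \<Rightarrow>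
     (nat \<Rightarrow> (int \<times> int \<times> int) set) \<Rightarrow> (nat \<Rightarrow> (int \<times> int \<times> int) set)" where
  "transfer \<Gamma>' M c = (\<lambda>n. \<Gamma>' n <#>\<^bsub>heis\<^esub> c (M n))"

context
  fixes \<Gamma> \<Gamma>' :: "nat \<Rightarrow> (int \<times> int \<times> int) set" and M :: "nat \<Rightarrow> nat"
  assumes odo: "heis_odometer \<Gamma>" and odo': "heis_odometer \<Gamma>'"
    and mono: "mono M" and sub: "\<And>n. \<Gamma> (M n) \<subseteq> \<Gamma>' n"
begin

lemma transfer_coset:
  "c (M n) = \<Gamma> (M n) #>\<^bsub>heis\<^esub> h \<Longrightarrow> transfer \<Gamma>' M c n = \<Gamma>' n #>\<^bsub>heis\<^esub> h"
  using sub
  by (simp add: transfer_def heis.set_mult_r_coset_absorb odometer_subgroup[OF odo]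
      odometer_subgroup[OF odo'])

lemma transfer_inv_limit:
  assumes c: "c \<in> inv_limit \<Gamma>"
  shows "transfer \<Gamma>' M c \<in> inv_limit \<Gamma>'"
proof -
  have "transfer \<Gamma>' M c n \<in> carrier (heis Mod \<Gamma>' n) \<and>
        \<Gamma>' n <#>\<^bsub>heis\<^esub> transfer \<Gamma>' M c (Suc n) = transfer \<Gamma>' M c n" for n
  proof -
    obtain h where "\<And>j. j \<le> M (Suc n) \<Longrightarrow> c j = \<Gamma> j #>\<^bsub>heis\<^esub> h"
      using inv_limit_coset[OF odo c] by blast
    moreover have "M n \<le> M (Suc n)"
      using mono by (simp add: monoD)
    ultimately have "transfer \<Gamma>' M c n = \<Gamma>' n #>\<^bsub>heis\<^esub> h"
      and "transfer \<Gamma>' M c (Suc n) = \<Gamma>' (Suc n) #>\<^bsub>heis\<^esub> h"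
      by (simp_all add: transfer_coset)
    then show ?thesis
      by (simp add: odometer_absorb[OF odo'] carrier_FactGroup)
  qed
  then show ?thesis
    by (simp add: inv_limit_def)
qed

lemma transfer_equivariant:
  assumes c: "c \<in> inv_limit \<Gamma>"
  shows "transfer \<Gamma>' M (odometer_action \<Gamma> h c) = odometer_action \<Gamma>' h (transfer \<Gamma>' M c)"
proof
  fix n
  obtain g where "\<And>j. j \<le> M n \<Longrightarrow> c j = \<Gamma> j #>\<^bsub>heis\<^esub> g"
    using inv_limit_coset[OF odo c] by blast
  then have g: "c (M n) = \<Gamma> (M n) #>\<^bsub>heis\<^esub> g"
    by simp
  have "transfer \<Gamma>' M (odometer_action \<Gamma> h c) n = \<Gamma>' n #>\<^bsub>heis\<^esub> (h \<otimes>\<^bsub>heis\<^esub> g)"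
    by (intro transfer_coset odometer_action_coset[OF odo] g)
  moreover have "odometer_action \<Gamma>' h (transfer \<Gamma>' M c) n = \<Gamma>' n #>\<^bsub>heis\<^esub> (h \<otimes>\<^bsub>heis\<^esub> g)"
    by (intro transfer_coset odometer_action_coset[OF odo'] g)
  ultimately show "transfer \<Gamma>' M (odometer_action \<Gamma> h c) n
      = odometer_action \<Gamma>' h (transfer \<Gamma>' M c) n"
    by simp
qed

lemma continuous_map_transfer:
  "continuous_map (inv_limit_topology \<Gamma>) (inv_limit_topology \<Gamma>') (transfer \<Gamma>' M)"
proof -
  have coord: "continuous_map (inv_limit_topology \<Gamma>)
      (discrete_topology (carrier (heis Mod \<Gamma>' n))) (\<lambda>c. transfer \<Gamma>' M c n)" for n
  proof -
    have "continuous_map (inv_limit_topology \<Gamma>)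
        (discrete_topology (carrier (heis Mod \<Gamma> (M n)))) (\<lambda>c. c (M n))"
      unfolding inv_limit_topology_def
      by (intro continuous_map_from_subtopology continuous_map_product_projection) simp
    moreover have "continuous_map (discrete_topology (carrier (heis Mod \<Gamma> (M n))))
        (discrete_topology (carrier (heis Mod \<Gamma>' n))) (\<lambda>C. \<Gamma>' n <#>\<^bsub>heis\<^esub> C)"
      using sub
      by (auto simp: carrier_FactGroup heis.set_mult_r_coset_absorb odometer_subgroup[OF odo]
          odometer_subgroup[OF odo'])
    ultimately have "continuous_map (inv_limit_topology \<Gamma>)
        (discrete_topology (carrier (heis Mod \<Gamma>' n))) ((\<lambda>C. \<Gamma>' n <#>\<^bsub>heis\<^esub> C) \<circ> (\<lambda>c. c (M n)))"
      by (rule continuous_map_compose)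
    then show ?thesis
      by (simp add: transfer_def o_def)
  qed
  have "transfer \<Gamma>' M \<in> inv_limit \<Gamma> \<rightarrow> inv_limit \<Gamma>'"
    using transfer_inv_limit by blast
  then show ?thesis
    unfolding inv_limit_topology_def[of \<Gamma>']
    using coord topspace_inv_limit[OF odo]
    by (simp add: continuous_map_in_subtopology continuous_map_componentwise_UNIV image_subset_iff)
qed

end

lemma transfer_transfer:
  assumes odo: "heis_odometer \<Gamma>" "heis_odometer \<Gamma>'"
    and M: "mono M" "\<And>n. n \<le> M n" "\<And>n. \<Gamma> (M n) \<subseteq> \<Gamma>' n"
    and M': "mono M'" "\<And>n. n \<le> M' n" "\<And>n. \<Gamma>' (M' n) \<subseteq> \<Gamma> n"
    and c: "c \<in> inv_limit \<Gamma>"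
  shows "transfer \<Gamma> M' (transfer \<Gamma>' M c) = c"
proof
  fix n
  obtain h where h: "\<And>j. j \<le> M (M' n) \<Longrightarrow> c j = \<Gamma> j #>\<^bsub>heis\<^esub> h"
    using inv_limit_coset[OF odo(1) c] by blast
  have "transfer \<Gamma>' M c (M' n) = \<Gamma>' (M' n) #>\<^bsub>heis\<^esub> h"
    by (rule transfer_coset[OF odo M(1,3)]) (simp add: h)
  then have "transfer \<Gamma> M' (transfer \<Gamma>' M c) n = \<Gamma> n #>\<^bsub>heis\<^esub> h"
    by (rule transfer_coset[OF odo(2,1) M'(1,3)])
  moreover have "n \<le> M (M' n)"
    using M(2) M'(2) le_trans by blast
  ultimately show "transfer \<Gamma> M' (transfer \<Gamma>' M c) n = c n"
    by (simp add: h)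
qed

lemma conjugate_if_refines:
  assumes odo: "heis_odometer \<Gamma>" "heis_odometer \<Gamma>'"
    and ref: "seq_refines \<Gamma> \<Gamma>'" "seq_refines \<Gamma>' \<Gamma>"
  shows "conjugate_odometers \<Gamma> \<Gamma>'"
proof -
  obtain M where M: "mono M" "\<And>n. n \<le> M n" "\<And>n. \<Gamma> (M n) \<subseteq> \<Gamma>' n"
    using seq_refines_mono_index[OF ref(1) odometer_decseq[OF odo(1)]] by blast
  obtain M' where M': "mono M'" "\<And>n. n \<le> M' n" "\<And>n. \<Gamma>' (M' n) \<subseteq> \<Gamma> n"
    using seq_refines_mono_index[OF ref(2) odometer_decseq[OF odo(2)]] by blast
  have "homeomorphic_maps (inv_limit_topology \<Gamma>) (inv_limit_topology \<Gamma>')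
          (transfer \<Gamma>' M) (transfer \<Gamma> M')"
    unfolding homeomorphic_maps_def topspace_inv_limit[OF odo(1)] topspace_inv_limit[OF odo(2)]
    using continuous_map_transfer[OF odo M(1,3)] continuous_map_transfer[OF odo(2,1) M'(1,3)]
      transfer_transfer[OF odo M M'] transfer_transfer[OF odo(2,1) M' M]
    by blast
  then show ?thesis
    unfolding conjugate_odometers_def
    using homeomorphic_maps_imp_map transfer_equivariant[OF odo M(1,3)] by blast
qed

text \<open>An element of \<open>\<Gamma> m\<close> moves the base point (the sequence of trivial cosets, that is, \<open>\<Gamma>\<close>
  itself) without changing its coordinates up to \<open>m\<close>. By continuity its effect on the \<open>n\<close>-th
  coordinate of the image point is trivial once \<open>m\<close> is large, and it acts on that coordinate by
  translation in a group, so it lies in \<open>\<Gamma>' n\<close>.\<close>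

lemma seq_refines_if_equivariant_map:
  assumes odo: "heis_odometer \<Gamma>" and odo': "heis_odometer \<Gamma>'"
    and cont: "continuous_map (inv_limit_topology \<Gamma>) (inv_limit_topology \<Gamma>') \<phi>"
    and equi: "\<And>h c. c \<in> inv_limit \<Gamma> \<Longrightarrow>
                \<phi> (odometer_action \<Gamma> h c) = odometer_action \<Gamma>' h (\<phi> c)"
  shows "seq_refines \<Gamma> \<Gamma>'"
  unfolding seq_refines_def
proof
  fix n
  let ?D = "\<lambda>i. discrete_topology (carrier (heis Mod \<Gamma> i))"
  have \<phi>: "\<phi> \<Gamma> \<in> inv_limit \<Gamma>'"
    using inv_limit_self[OF odo] continuous_map_image_subset_topspace[OF cont]
    unfolding topspace_inv_limit[OF odo] topspace_inv_limit[OF odo'] by blast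
  have "continuous_map (inv_limit_topology \<Gamma>')
      (discrete_topology (carrier (heis Mod \<Gamma>' n))) (\<lambda>c. c n)"
    unfolding inv_limit_topology_def
    by (intro continuous_map_from_subtopology continuous_map_product_projection) simp
  from continuous_map_compose[OF cont this]
  have "continuous_map (inv_limit_topology \<Gamma>)
      (discrete_topology (carrier (heis Mod \<Gamma>' n))) (\<lambda>c. \<phi> c n)"
    by (simp add: o_def)
  moreover have "openin (discrete_topology (carrier (heis Mod \<Gamma>' n))) {\<phi> \<Gamma> n}"
    using \<phi> by (auto simp: inv_limit_def)
  ultimately have "openin (inv_limit_topology \<Gamma>) {c \<in> inv_limit \<Gamma>. \<phi> c n \<in> {\<phi> \<Gamma> n}}"
    unfolding topspace_inv_limit[OF odo, symmetric] by (rule openin_continuous_map_preimage)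
  then obtain T where T: "openin (product_topology ?D UNIV) T"
      "{c \<in> inv_limit \<Gamma>. \<phi> c n \<in> {\<phi> \<Gamma> n}} = T \<inter> inv_limit \<Gamma>"
    unfolding inv_limit_topology_def openin_subtopology by blast
  have "\<Gamma> \<in> T"
    using T(2) inv_limit_self[OF odo] by blast
  then obtain X where X: "\<Gamma> \<in> (\<Pi>\<^sub>E i\<in>UNIV. X i)" "finite {i. X i \<noteq> topspace (?D i)}"
      "(\<Pi>\<^sub>E i\<in>UNIV. X i) \<subseteq> T"
    using product_topology_open_contains_basis[OF T(1)] by blast
  define m where "m = Max (insert 0 {i. X i \<noteq> topspace (?D i)})"
  have "\<Gamma> m \<subseteq> \<Gamma>' n"
  proof
    fix h assume h: "h \<in> \<Gamma> m"
    let ?c = "odometer_action \<Gamma> h \<Gamma>"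
    have c: "?c \<in> inv_limit \<Gamma>"
      by (intro odometer_action_inv_limit[OF odo] inv_limit_self[OF odo])
    have "?c i \<in> X i" for i
    proof (cases "X i = topspace (?D i)")
      case True
      then show ?thesis
        using c by (auto simp: inv_limit_def)
    next
      case False
      then have "i \<le> m"
        using X(2) by (simp add: m_def)
      then have "h \<in> \<Gamma> i"
        using h decseqD[OF odometer_decseq[OF odo]] by blast
      moreover have "?c i = \<Gamma> i #>\<^bsub>heis\<^esub> (h \<otimes>\<^bsub>heis\<^esub> \<one>\<^bsub>heis\<^esub>)"
        by (rule odometer_action_coset[OF odo]) (simp add: heis.coset_mult_one del: one_heis)
      ultimately have "?c i = \<Gamma> i"
        using heis.r_coset_eq_iff_mem[OF odometer_subgroup[OF odo]]
        by (simp del: one_heis)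
      then show ?thesis
        using X(1) by (auto simp: PiE_iff)
    qed
    then have "?c \<in> T"
      using X(3) by (auto simp: PiE_iff)
    then have "\<phi> ?c n = \<phi> \<Gamma> n"
      using T(2) c by blast
    then have act: "odometer_action \<Gamma>' h (\<phi> \<Gamma>) n = \<phi> \<Gamma> n"
      using equi[OF inv_limit_self[OF odo]] by simp
    interpret Q: group "heis Mod \<Gamma>' n"
      by (rule normal.factorgroup_is_group[OF odometer_normal[OF odo']])
    have "\<Gamma>' n #>\<^bsub>heis\<^esub> h \<in> carrier (heis Mod \<Gamma>' n)" "\<phi> \<Gamma> n \<in> carrier (heis Mod \<Gamma>' n)"
      using \<phi> by (auto simp: carrier_FactGroup inv_limit_def)
    then have "\<Gamma>' n #>\<^bsub>heis\<^esub> h = \<one>\<^bsub>heis Mod \<Gamma>' n\<^esub>"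
      using act by (simp add: odometer_action_def Q.r_cancel_one del: mult_FactGroup one_FactGroup)
    then show "h \<in> \<Gamma>' n"
      using heis.r_coset_eq_iff_mem[OF odometer_subgroup[OF odo']] by simp
  qed
  then show "\<exists>m. \<Gamma> m \<subseteq> \<Gamma>' n" ..
qed

lemma conjugate_iff_refines:
  assumes odo: "heis_odometer \<Gamma>" "heis_odometer \<Gamma>'"
  shows "conjugate_odometers \<Gamma> \<Gamma>' \<longleftrightarrow> seq_refines \<Gamma> \<Gamma>' \<and> seq_refines \<Gamma>' \<Gamma>"
proof
  assume "conjugate_odometers \<Gamma> \<Gamma>'"
  then obtain \<phi> \<psi> where
    maps: "homeomorphic_maps (inv_limit_topology \<Gamma>) (inv_limit_topology \<Gamma>') \<phi> \<psi>"
    and equi: "\<And>h c. c \<in> inv_limit \<Gamma> \<Longrightarrow>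
                \<phi> (odometer_action \<Gamma> h c) = odometer_action \<Gamma>' h (\<phi> c)"
    unfolding conjugate_odometers_def homeomorphic_map_maps by auto
  have cont: "continuous_map (inv_limit_topology \<Gamma>) (inv_limit_topology \<Gamma>') \<phi>"
      "continuous_map (inv_limit_topology \<Gamma>') (inv_limit_topology \<Gamma>) \<psi>"
    and inverse: "\<And>c. c \<in> inv_limit \<Gamma> \<Longrightarrow> \<psi> (\<phi> c) = c" "\<And>c. c \<in> inv_limit \<Gamma>' \<Longrightarrow> \<phi> (\<psi> c) = c"
    using maps
    by (auto simp: homeomorphic_maps_def topspace_inv_limit[OF odo(1)]
        topspace_inv_limit[OF odo(2)])
  have "\<psi> (odometer_action \<Gamma>' h c) = odometer_action \<Gamma> h (\<psi> c)" if c: "c \<in> inv_limit \<Gamma>'" for h c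
  proof -
    have \<psi>: "\<psi> c \<in> inv_limit \<Gamma>"
      using c continuous_map_image_subset_topspace[OF cont(2)]
      unfolding topspace_inv_limit[OF odo(1)] topspace_inv_limit[OF odo(2)] by blast
    then have "odometer_action \<Gamma>' h c = \<phi> (odometer_action \<Gamma> h (\<psi> c))"
      using equi inverse(2)[OF c] by simp
    then show ?thesis
      using inverse(1) odometer_action_inv_limit[OF odo(1) \<psi>] by simp
  qed
  then show "seq_refines \<Gamma> \<Gamma>' \<and> seq_refines \<Gamma>' \<Gamma>"
    using seq_refines_if_equivariant_map[OF odo cont(1) equi]
      seq_refines_if_equivariant_map[OF odo(2,1) cont(2)] by blast
qed (use conjugate_if_refines[OF odo] in blast)

section \<open>Normal subgroups of the Heisenberg group\<close>

text \<open>Conjugating \<open>(x, y, z)\<close> by \<open>(a, b, c)\<close> gives \<open>(x, y, z + a * y - b * x)\<close>.\<close>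

lemma normal_heisI:
  assumes one: "(0, 0, 0) \<in> N"
    and mult: "\<And>x y z x' y' z'. (x, y, z) \<in> N \<Longrightarrow> (x', y', z') \<in> N \<Longrightarrow>
                 (x + x', y + y', z + z' + x * y') \<in> N"
    and inv: "\<And>x y z. (x, y, z) \<in> N \<Longrightarrow> (- x, - y, x * y - z) \<in> N"
    and conj: "\<And>x y z a b. (x, y, z) \<in> N \<Longrightarrow> (x, y, z + a * y - b * x) \<in> N"
  shows "N \<lhd> heis"
proof (rule heis.normal_invI)
  show "subgroup N heis"
  proof (rule heis.subgroupI)
    show "inv\<^bsub>heis\<^esub> p \<in> N" if "p \<in> N" for p
      using that inv by (cases p) simp
    show "p \<otimes>\<^bsub>heis\<^esub> q \<in> N" if "p \<in> N" "q \<in> N" for p q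
      using that mult by (cases p, cases q) simp
  qed (use one in auto)
  show "x \<otimes>\<^bsub>heis\<^esub> h \<otimes>\<^bsub>heis\<^esub> inv\<^bsub>heis\<^esub> x \<in> N" if "h \<in> N" for x h
  proof -
    obtain a b c x' y' z' where "x = (a, b, c)" "h = (x', y', z')"
      by (cases x, cases h) auto
    then show ?thesis
      using that conj[of x' y' z' a b] by (simp add: algebra_simps)
  qed
qed

lemma normal_heis_mult:
  assumes "N \<lhd> heis" "(x, y, z) \<in> N" "(x', y', z') \<in> N"
  shows "(x + x', y + y', z + z' + x * y') \<in> N"
  using subgroup.m_closed[OF normal_imp_subgroup[OF assms(1)] assms(2,3)] by simp

lemma normal_heis_inv:
  assumes "N \<lhd> heis" "(x, y, z) \<in> N"
  shows "(- x, - y, x * y - z) \<in> N"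
  using subgroup.m_inv_closed[OF normal_imp_subgroup[OF assms(1)] assms(2)] by simp

lemma normal_heis_commutator:
  assumes "N \<lhd> heis" "(x, y, z) \<in> N"
  shows "(0, 0, a * y - b * x) \<in> N"
proof -
  have "(a, b, 0) \<otimes>\<^bsub>heis\<^esub> (x, y, z) \<otimes>\<^bsub>heis\<^esub> inv\<^bsub>heis\<^esub> (a, b, 0) \<in> N"
    using assms by (intro normal.inv_op_closed2) auto
  then have "(x, y, z + a * y - b * x) \<in> N"
    by (simp add: algebra_simps)
  from normal_heis_mult[OF assms(1) this normal_heis_inv[OF assms]] show ?thesis
    by simp
qed

text \<open>By the pigeonhole principle, two of the elements \<open>(0, 0, k)\<close> lie in the same coset.\<close>

lemma finite_index_central:
  assumes N: "N \<lhd> heis" and fin: "finite (carrier (heis Mod N))"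
  obtains k where "0 < k" "(0, 0, k) \<in> N"
proof -
  let ?C = "\<lambda>k::nat. N #>\<^bsub>heis\<^esub> (0, 0, int k)"
  have "finite (range ?C)"
    by (rule finite_subset[OF _ fin]) (auto simp: carrier_FactGroup)
  then have "\<not> inj ?C"
    using finite_imageD infinite_UNIV_nat by blast
  then obtain i j :: nat where "i < j" "?C i = ?C j"
    unfolding inj_on_def by (metis linorder_neqE_nat)
  have "(0, 0, int j) \<in> ?C j"
    using normal_imp_subgroup[OF N] by (intro heis.rcos_self) auto
  then have "(0, 0, int j) \<in> ?C i"
    using \<open>?C i = ?C j\<close> by simp
  then obtain n where n: "n \<in> N" "n \<otimes>\<^bsub>heis\<^esub> (0, 0, int i) = (0, 0, int j)"
    by (auto simp: r_coset_def)
  then have "n = (0, 0, int j - int i)"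
    by (cases n) auto
  then show thesis
    using n \<open>i < j\<close> that[of "int j - int i"] by simp
qed

text \<open>The minimum in \<open>min_height\<close> is attained: central elements of the subgroup
  lift any height to a nonnegative one.\<close>

lemma flat_subgroup_iff:
  assumes N: "N \<lhd> heis" and fin: "finite (carrier (heis Mod N))"
  shows "flat_subgroup N \<longleftrightarrow> (\<forall>x y z. (x, y, z) \<in> N \<longrightarrow> (x, y, 0) \<in> N)"
proof -
  have "(LEAST w. 0 \<le> w \<and> (x, y, w) \<in> N) = 0 \<longleftrightarrow> (x, y, 0) \<in> N" if z: "(x, y, z) \<in> N" for x y z
  proof
    assume "(x, y, 0) \<in> N"
    then show "(LEAST w. 0 \<le> w \<and> (x, y, w) \<in> N) = 0"
      by (intro Least_equality) auto
  next
    assume least: "(LEAST w. 0 \<le> w \<and> (x, y, w) \<in> N) = 0"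
    obtain k where k: "0 < k" "(0, 0, k) \<in> N"
      using finite_index_central[OF N fin] .
    have multiple: "(x, y, z + int i * k) \<in> N" for i
    proof (induction i)
      case (Suc i)
      from normal_heis_mult[OF N Suc k(2)] show ?case
        by (simp add: algebra_simps)
    qed (use z in simp)
    have "0 \<le> z + int (nat \<bar>z\<bar>) * k"
    proof -
      have "\<bar>z\<bar> * 1 \<le> \<bar>z\<bar> * k"
        using k(1) by (intro mult_left_mono) auto
      then show ?thesis by simp
    qed
    then obtain w where w: "0 \<le> w" "(x, y, w) \<in> N"
      using multiple by blast
    define m where "m = (LEAST m::nat. (x, y, int m) \<in> N)"
    have "(x, y, int m) \<in> N"
      unfolding m_def by (rule LeastI[of _ "nat w"]) (use w in simp)
    moreover have "int m \<le> v" if "0 \<le> v" "(x, y, v) \<in> N" for v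
      using Least_le[of "\<lambda>m::nat. (x, y, int m) \<in> N" "nat v"] that by (simp add: m_def)
    ultimately have "(LEAST w. 0 \<le> w \<and> (x, y, w) \<in> N) = int m"
      by (intro Least_equality) auto
    then show "(x, y, 0) \<in> N"
      using least \<open>(x, y, int m) \<in> N\<close> by simp
  qed
  then show ?thesis
    by (fastforce simp: flat_subgroup_def min_height_def heis_proj_def)
qed

lemma diagonal_mult_vector:
  fixes A :: "int ^ 2 ^ 2"
  assumes "\<forall>i j. i \<noteq> j \<longrightarrow> A $ i $ j = 0"
  shows "A *v v = vector [A $ 1 $ 1 * v $ 1, A $ 2 $ 2 * v $ 2]"
  using assms by (auto simp: vec_eq_iff forall_2 matrix_vector_mult_def sum_2)

lemma vector_2_eq_iff: "vector [a, b] = (vector [c, d] :: int ^ 2) \<longleftrightarrow> a = c \<and> b = d"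
  by (auto simp: vec_eq_iff forall_2)

lemma xy_product_subgroup_iff:
  "xy_product_subgroup N \<longleftrightarrow>
     (\<exists>a b. a \<noteq> 0 \<and> b \<noteq> 0 \<and> (\<forall>x y. (\<exists>z. (x, y, z) \<in> N) \<longleftrightarrow> a dvd x \<and> b dvd y))"
proof -
  have proj: "vector [x, y] \<in> heis_proj ` N \<longleftrightarrow> (\<exists>z. (x, y, z) \<in> N)" for x y
    by (force simp: heis_proj_def image_iff vector_2_eq_iff)
  have vec: "\<exists>x y. v = vector [x, y]" for v :: "int ^ 2"
    by (intro exI[of _ "v $ 1"] exI[of _ "v $ 2"]) (simp add: vec_eq_iff forall_2)
  have range: "vector [x, y] \<in> range (\<lambda>v. A *v v) \<longleftrightarrow> A $ 1 $ 1 dvd x \<and> A $ 2 $ 2 dvd y"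
    if "\<forall>i j. i \<noteq> j \<longrightarrow> A $ i $ j = 0" for x y and A :: "int ^ 2 ^ 2"
  proof
    assume "vector [x, y] \<in> range (\<lambda>v. A *v v)"
    then show "A $ 1 $ 1 dvd x \<and> A $ 2 $ 2 dvd y"
      by (auto simp: diagonal_mult_vector[OF that] vector_2_eq_iff)
  next
    assume "A $ 1 $ 1 dvd x \<and> A $ 2 $ 2 dvd y"
    then obtain s t where "x = A $ 1 $ 1 * s" "y = A $ 2 $ 2 * t"
      by (auto simp: dvd_def)
    then have "vector [x, y] = A *v vector [s, t]"
      by (simp add: diagonal_mult_vector[OF that])
    then show "vector [x, y] \<in> range (\<lambda>v. A *v v)"
      by blast
  qed
  have eq_iff: "S = T \<longleftrightarrow> (\<forall>x y. vector [x, y] \<in> S \<longleftrightarrow> vector [x, y] \<in> T)" for S T :: "(int ^ 2) set"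
    using vec by (metis subsetI subset_antisym)
  show ?thesis
  proof
    assume "xy_product_subgroup N"
    then obtain A :: "int ^ 2 ^ 2" where A: "\<forall>i j. i \<noteq> j \<longrightarrow> A $ i $ j = 0" "det A \<noteq> 0"
        "heis_proj ` N = range (\<lambda>v. A *v v)"
      unfolding xy_product_subgroup_def by blast
    then have "\<forall>x y. (\<exists>z. (x, y, z) \<in> N) \<longleftrightarrow> A $ 1 $ 1 dvd x \<and> A $ 2 $ 2 dvd y"
      using range[OF A(1)] proj by metis
    then show "\<exists>a b. a \<noteq> 0 \<and> b \<noteq> 0 \<and> (\<forall>x y. (\<exists>z. (x, y, z) \<in> N) \<longleftrightarrow> a dvd x \<and> b dvd y)"
      using A(1,2) by (intro exI[of _ "A $ 1 $ 1"] exI[of _ "A $ 2 $ 2"]) (auto simp: det_2)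
  next
    assume "\<exists>a b. a \<noteq> 0 \<and> b \<noteq> 0 \<and> (\<forall>x y. (\<exists>z. (x, y, z) \<in> N) \<longleftrightarrow> a dvd x \<and> b dvd y)"
    then obtain a b where ab: "a \<noteq> 0" "b \<noteq> 0"
      "\<And>x y. (\<exists>z. (x, y, z) \<in> N) \<longleftrightarrow> a dvd x \<and> b dvd y"
      by blast
    define A :: "int ^ 2 ^ 2" where "A = vector [vector [a, 0], vector [0, b]]"
    have diag: "\<forall>i j. i \<noteq> j \<longrightarrow> A $ i $ j = 0"
      by (simp add: A_def forall_2)
    moreover have "A $ 1 $ 1 = a" "A $ 2 $ 2 = b"
      by (simp_all add: A_def)
    moreover from this have "det A \<noteq> 0"
      using ab(1,2) diag by (simp add: det_2)
    moreover have "heis_proj ` N = range (\<lambda>v. A *v v)"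
      unfolding eq_iff proj range[OF diag] using ab(3) \<open>A $ 1 $ 1 = a\<close> \<open>A $ 2 $ 2 = b\<close> by simp
    ultimately show "xy_product_subgroup N"
      unfolding xy_product_subgroup_def by blast
  qed
qed

section \<open>Flat product odometers are pure product\<close>

text \<open>For normal subgroups \<open>P \<subseteq> F\<close> with \<open>F\<close> flat, this is a normal subgroup between \<open>P\<close> and
  \<open>F\<close>: it keeps the horizontal projection of \<open>P\<close> and takes over the heights of \<open>F\<close>.\<close>

definition flattening :: "(int \<times> int \<times> int) set \<Rightarrow> (int \<times> int \<times> int) set \<Rightarrow>
    (int \<times> int \<times> int) set" where
  "flattening P F = {(x, y, z). (\<exists>w. (x, y, w) \<in> P) \<and> (0, 0, z) \<in> F}"

context
  fixes P F :: "(int \<times> int \<times> int) set"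
  assumes P: "P \<lhd> heis" and F: "F \<lhd> heis" and PF: "P \<subseteq> F"
begin

lemma flattening_normal: "flattening P F \<lhd> heis"
proof (rule normal_heisI)
  have add: "(0, 0, z + t) \<in> F" if "(0, 0, z) \<in> F" "(0, 0, t) \<in> F" for z t
    using normal_heis_mult[OF F that] by simp
  \<comment> \<open>Commutators of elements of \<open>P\<close> account for every height that the product, the inverse and
    conjugation add.\<close>
  have comm: "(0, 0, a * y - b * x) \<in> F" if "(x, y, w) \<in> P" for x y w a b
    using normal_heis_commutator[OF F] that PF by blast
  show "(0, 0, 0) \<in> flattening P F"
    using subgroup.one_closed[OF normal_imp_subgroup[OF P]] PF by (auto simp: flattening_def)
  show "(x + x', y + y', z + z' + x * y') \<in> flattening P F"
    if prems: "(x, y, z) \<in> flattening P F" "(x', y', z') \<in> flattening P F"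
    for x y z x' y' z'
  proof -
    obtain w w' where w: "(x, y, w) \<in> P" "(x', y', w') \<in> P" "(0, 0, z) \<in> F" "(0, 0, z') \<in> F"
      using prems by (auto simp: flattening_def)
    have "(0, 0, z + z' + x * y') \<in> F"
      using add[OF add[OF w(3,4)] comm[OF w(1), of 0 "- y'"]] by (simp add: mult.commute)
    then show ?thesis
      using normal_heis_mult[OF P w(1,2)] by (auto simp: flattening_def)
  qed
  show "(- x, - y, x * y - z) \<in> flattening P F" if prems: "(x, y, z) \<in> flattening P F" for x y z
  proof -
    obtain w where w: "(x, y, w) \<in> P" "(0, 0, z) \<in> F"
      using prems by (auto simp: flattening_def)
    have "(0, 0, - z) \<in> F"
      using normal_heis_inv[OF F w(2)] by simp
    from add[OF comm[OF w(1), of x 0] this] have "(0, 0, x * y - z) \<in> F"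
      by simp
    then show ?thesis
      using normal_heis_inv[OF P w(1)] by (auto simp: flattening_def)
  qed
  show "(x, y, z + a * y - b * x) \<in> flattening P F" if "(x, y, z) \<in> flattening P F" for x y z a b
    using that add comm by (fastforce simp: flattening_def add_diff_eq[symmetric])
qed

lemma subset_flattening:
  assumes flat: "\<forall>x y z. (x, y, z) \<in> F \<longrightarrow> (x, y, 0) \<in> F"
  shows "P \<subseteq> flattening P F"
proof
  fix p assume p: "p \<in> P"
  obtain x y z where xyz: "p = (x, y, z)"
    by (cases p)
  then have "(x, y, z) \<in> F"
    using p PF by blast
  moreover from this have "(x, y, 0) \<in> F"
    using flat by blast
  ultimately have "(0, 0, z) \<in> F"
    using normal_heis_mult[OF F _ normal_heis_inv[OF F]] by fastforce
  then show "p \<in> flattening P F"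
    using p xyz by (auto simp: flattening_def)
qed

lemma flattening_subset:
  assumes flat: "\<forall>x y z. (x, y, z) \<in> F \<longrightarrow> (x, y, 0) \<in> F"
  shows "flattening P F \<subseteq> F"
proof
  fix p assume "p \<in> flattening P F"
  then obtain x y z w where p: "p = (x, y, z)" "(x, y, w) \<in> P" "(0, 0, z) \<in> F"
    by (auto simp: flattening_def)
  then have "(x, y, 0) \<in> F"
    using PF flat by blast
  from normal_heis_mult[OF F p(3) this] p(1) show "p \<in> F"
    by simp
qed

end

lemma xy_product_flattening:
  assumes "xy_product_subgroup P" "(0, 0, 0) \<in> F"
  shows "xy_product_subgroup (flattening P F)"
proof -
  have "(\<exists>z. (x, y, z) \<in> flattening P F) \<longleftrightarrow> (\<exists>z. (x, y, z) \<in> P)" for x y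
    using assms(2) by (auto simp: flattening_def)
  then show ?thesis
    using assms(1) by (simp add: xy_product_subgroup_iff)
qed

lemma flattening_mono: "P \<subseteq> P' \<Longrightarrow> F \<subseteq> F' \<Longrightarrow> flattening P F \<subseteq> flattening P' F'"
  by (auto simp: flattening_def)

text \<open>The flattenings \<open>\<Lambda> n\<close> satisfy \<open>P (M n) \<subseteq> \<Lambda> n \<subseteq> F n\<close>, so they inherit cofinality with \<open>\<Gamma>\<close>
  from both sides.\<close>

lemma pure_product_odometer_if_flat_xy_product:
  assumes odo: "heis_odometer \<Gamma>" and flat: "flat_odometer \<Gamma>" and xy: "xy_product_odometer \<Gamma>"
  shows "pure_product_odometer \<Gamma>"
proof -
  obtain F where F: "heis_odometer F" "seq_refines \<Gamma> F" "seq_refines F \<Gamma>" "\<And>n. flat_subgroup (F n)"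
    using flat conjugate_iff_refines[OF odo] unfolding flat_odometer_def by blast
  obtain P where P: "heis_odometer P" "seq_refines \<Gamma> P" "seq_refines P \<Gamma>" "\<And>n. xy_product_subgroup (P n)"
    using xy conjugate_iff_refines[OF odo] unfolding xy_product_odometer_def by blast
  have "seq_refines P F"
    using P(3) F(2) by (rule seq_refines_trans)
  then obtain M where M: "mono M" "\<And>n. n \<le> M n" "\<And>n. P (M n) \<subseteq> F n"
    using seq_refines_mono_index odometer_decseq[OF P(1)] by blast
  define \<Lambda> where "\<Lambda> n = flattening (P (M n)) (F n)" for n
  have F0: "(x, y, 0) \<in> F n" if "(x, y, z) \<in> F n" for n x y z
    using flat_subgroup_iff[OF odometer_normal[OF F(1)] odometer_finite[OF F(1)]] F(4) that
    by blast
  have one: "(0, 0, 0) \<in> F n" for n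
    using subgroup.one_closed[OF odometer_subgroup[OF F(1)]] by simp
  have normal: "\<Lambda> n \<lhd> heis" for n
    unfolding \<Lambda>_def by (intro flattening_normal odometer_normal P F M)
  have lower: "P (M n) \<subseteq> \<Lambda> n" for n
    unfolding \<Lambda>_def using F0 by (intro subset_flattening odometer_normal P F M) blast
  have upper: "\<Lambda> n \<subseteq> F n" for n
    unfolding \<Lambda>_def using F0 by (intro flattening_subset odometer_normal P F M) blast
  have fin: "finite (carrier (heis Mod \<Lambda> n))" for n
    using lower odometer_finite[OF P(1)] odometer_subgroup[OF P(1)] normal
    by (meson heis.finite_FactGroup_mono normal_imp_subgroup)
  have "decseq \<Lambda>"
    unfolding \<Lambda>_def decseq_def
    using decseqD[OF odometer_decseq[OF P(1)]] decseqD[OF odometer_decseq[OF F(1)]] monoD[OF M(1)]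
    by (intro allI impI flattening_mono) auto
  moreover have "(\<Inter>n. \<Lambda> n) = {\<one>\<^bsub>heis\<^esub>}"
  proof
    show "(\<Inter>n. \<Lambda> n) \<subseteq> {\<one>\<^bsub>heis\<^esub>}"
      using upper F(1) unfolding heis_odometer_def by blast
    show "{\<one>\<^bsub>heis\<^esub>} \<subseteq> (\<Inter>n. \<Lambda> n)"
      using subgroup.one_closed[OF normal_imp_subgroup[OF normal]] by blast
  qed
  ultimately have \<Lambda>: "heis_odometer \<Lambda>"
    using normal fin by (simp add: heis_odometer_def)
  have "seq_refines P \<Lambda>" "seq_refines \<Lambda> F"
    using lower upper unfolding seq_refines_def by blast+
  then have "seq_refines \<Gamma> \<Lambda>" "seq_refines \<Lambda> \<Gamma>"
    using P(2) F(3) seq_refines_trans by blast+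
  then have "conjugate_odometers \<Gamma> \<Lambda>"
    using conjugate_iff_refines[OF odo \<Lambda>] by blast
  moreover have "flat_subgroup (\<Lambda> n)" for n
    unfolding flat_subgroup_iff[OF normal fin] using one by (auto simp: \<Lambda>_def flattening_def)
  moreover have "xy_product_subgroup (\<Lambda> n)" for n
    unfolding \<Lambda>_def by (intro xy_product_flattening P one)
  ultimately show ?thesis
    using \<Lambda> unfolding pure_product_odometer_def pure_product_subgroup_def by blast
qed

section \<open>Four odometers\<close>

definition heis_cube :: "int \<Rightarrow> (int \<times> int \<times> int) set" where
  "heis_cube q = {(x, y, z). q dvd x \<and> q dvd y \<and> q dvd z}"

lemma heis_cube_normal: "heis_cube q \<lhd> heis"
  by (rule normal_heisI) (auto simp: heis_cube_def)

lemma heis_cube_finite: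
  assumes "0 < q"
  shows "finite (carrier (heis Mod heis_cube q))"
proof -
  let ?B = "{0..<q} \<times> {0..<q} \<times> {0..<q}"
  have "carrier (heis Mod heis_cube q) \<subseteq> (\<lambda>h. heis_cube q #>\<^bsub>heis\<^esub> h) ` ?B"
  proof
    fix C assume "C \<in> carrier (heis Mod heis_cube q)"
    then obtain x y z where C: "C = heis_cube q #>\<^bsub>heis\<^esub> (x, y, z)"
      by (auto simp: carrier_FactGroup)
    let ?r = "(x mod q, y mod q, z mod q)"
    \<comment> \<open>\<open>?d\<close> is the quotient of \<open>(x, y, z)\<close> by its reduced form \<open>?r\<close>.\<close>
    let ?d = "(x - x mod q, y - y mod q, (z - z mod q) - (x - x mod q) * (y mod q))"
    have "?d \<in> heis_cube q"
      by (auto simp: heis_cube_def minus_mod_eq_mult_div intro!: dvd_diff dvd_mult2)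
    then have "heis_cube q #>\<^bsub>heis\<^esub> ?d = heis_cube q"
      using heis.r_coset_eq_iff_mem[OF normal_imp_subgroup[OF heis_cube_normal]] by simp
    moreover have "(x, y, z) = ?d \<otimes>\<^bsub>heis\<^esub> ?r"
      by simp
    ultimately have "C = heis_cube q #>\<^bsub>heis\<^esub> ?r"
      using C heis.coset_mult_assoc[of "heis_cube q" ?d ?r] by simp
    moreover have "?r \<in> ?B"
      using assms by simp
    ultimately show "C \<in> (\<lambda>h. heis_cube q #>\<^bsub>heis\<^esub> h) ` ?B"
      by blast
  qed
  then show ?thesis
    by (rule finite_subset) simp
qed

text \<open>The cubes make the intersection of the sequence trivial. Since \<open>3 ^ n\<close> is odd, lying in a cube
  imposes nothing modulo \<open>4\<close>, so an obstruction expressed in \<open>K\<close> by a congruence modulo \<open>4\<close>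
  persists in every term.\<close>

definition cube_odometer :: "(int \<times> int \<times> int) set \<Rightarrow> nat \<Rightarrow> (int \<times> int \<times> int) set" where
  "cube_odometer K n = K \<inter> heis_cube (3 ^ n)"

lemma heis_odometer_cube:
  assumes K: "K \<lhd> heis" and "heis_cube 4 \<subseteq> K"
  shows "heis_odometer (cube_odometer K)"
  unfolding heis_odometer_def
proof (intro conjI allI)
  show normal: "cube_odometer K n \<lhd> heis" for n
    unfolding cube_odometer_def by (intro heis.normal_subgroup_intersect K heis_cube_normal)
  show "finite (carrier (heis Mod cube_odometer K n))" for n
  proof (rule heis.finite_FactGroup_mono)
    have "heis_cube (4 * 3 ^ n) \<subseteq> heis_cube 4 \<inter> heis_cube (3 ^ n)"
      by (auto simp: heis_cube_def dest: dvd_mult_left dvd_mult_right)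
    then show "heis_cube (4 * 3 ^ n) \<subseteq> cube_odometer K n"
      using assms(2) by (auto simp: cube_odometer_def)
    show "subgroup (cube_odometer K n) heis" "subgroup (heis_cube (4 * 3 ^ n)) heis"
      by (intro normal_imp_subgroup normal heis_cube_normal)+
  qed (simp add: heis_cube_finite)
  show "decseq (cube_odometer K)"
    unfolding decseq_def
  proof (intro allI impI)
    fix m n :: nat assume "m \<le> n"
    then have "(3::int) ^ m dvd 3 ^ n"
      by (rule le_imp_power_dvd)
    then show "cube_odometer K n \<subseteq> cube_odometer K m"
      by (auto simp: cube_odometer_def heis_cube_def intro: dvd_trans)
  qed
  show "(\<Inter>n. cube_odometer K n) = {\<one>\<^bsub>heis\<^esub>}"
  proof
    have zero: "x = 0" if "\<And>n. (3::int) ^ n dvd x" for x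
    proof (rule ccontr)
      assume "x \<noteq> 0"
      then have "(3::int) ^ nat \<bar>x\<bar> \<le> \<bar>x\<bar>"
        using dvd_imp_le_int[OF _ that[of "nat \<bar>x\<bar>"]] by simp
      moreover have "int (nat \<bar>x\<bar>) < int (3 ^ nat \<bar>x\<bar>)"
        unfolding of_nat_less_iff by (rule power_gt_expt) simp
      ultimately show False by simp
    qed
    show "(\<Inter>n. cube_odometer K n) \<subseteq> {\<one>\<^bsub>heis\<^esub>}"
      using zero by (auto simp: cube_odometer_def heis_cube_def)
    show "{\<one>\<^bsub>heis\<^esub>} \<subseteq> (\<Inter>n. cube_odometer K n)"
      using subgroup.one_closed[OF normal_imp_subgroup[OF normal]] by blast
  qed
qed

lemma flat_odometerI:
  assumes odo: "heis_odometer \<Gamma>" and "\<And>n x y z. (x, y, z) \<in> \<Gamma> n \<Longrightarrow> (x, y, 0) \<in> \<Gamma> n"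
  shows "flat_odometer \<Gamma>"
proof -
  have "flat_subgroup (\<Gamma> n)" for n
    using assms(2) flat_subgroup_iff[OF odometer_normal[OF odo] odometer_finite[OF odo]] by blast
  then show ?thesis
    using odo conjugate_if_refines[OF odo odo seq_refines_refl seq_refines_refl]
    unfolding flat_odometer_def by blast
qed

lemma xy_product_odometerI:
  assumes odo: "heis_odometer \<Gamma>" and nonzero: "\<And>n. a n \<noteq> 0" "\<And>n. b n \<noteq> 0"
    and "\<And>n x y. (\<exists>z. (x, y, z) \<in> \<Gamma> n) \<longleftrightarrow> a n dvd x \<and> b n dvd y"
  shows "xy_product_odometer \<Gamma>"
proof -
  have "xy_product_subgroup (\<Gamma> n)" for n
    unfolding xy_product_subgroup_iff
    by (intro exI[of _ "a n"] exI[of _ "b n"] conjI nonzero) (simp add: assms(4))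
  then show ?thesis
    using odo conjugate_if_refines[OF odo odo seq_refines_refl seq_refines_refl]
    unfolding xy_product_odometer_def by blast
qed

text \<open>A flat sequence conjugate to \<open>\<Gamma>\<close> has a term between some \<open>\<Gamma> m\<close> and \<open>\<Gamma> n\<close>. The next
  lemma uses a product sequence in the same way.\<close>

lemma flat_odometerD:
  assumes odo: "heis_odometer \<Gamma>" and "flat_odometer \<Gamma>"
  obtains m where "\<And>x y z. (x, y, z) \<in> \<Gamma> m \<Longrightarrow> (x, y, 0) \<in> \<Gamma> n"
proof -
  obtain F where F: "heis_odometer F" "seq_refines \<Gamma> F" "seq_refines F \<Gamma>" "\<And>n. flat_subgroup (F n)"
    using assms conjugate_iff_refines[OF odo] unfolding flat_odometer_def by blast
  obtain k where k: "F k \<subseteq> \<Gamma> n"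
    using F(3) unfolding seq_refines_def by blast
  obtain m where m: "\<Gamma> m \<subseteq> F k"
    using F(2) unfolding seq_refines_def by blast
  have "(x, y, 0) \<in> \<Gamma> n" if "(x, y, z) \<in> \<Gamma> m" for x y z
    using flat_subgroup_iff[OF odometer_normal[OF F(1)] odometer_finite[OF F(1)]] F(4) k m that
    by blast
  then show thesis by (rule that)
qed

lemma xy_product_odometerD:
  assumes odo: "heis_odometer \<Gamma>" and "xy_product_odometer \<Gamma>"
  obtains m a b where "\<And>x y z. (x, y, z) \<in> \<Gamma> m \<Longrightarrow> a dvd x \<and> b dvd y"
    and "\<And>x y. a dvd x \<Longrightarrow> b dvd y \<Longrightarrow> \<exists>z. (x, y, z) \<in> \<Gamma> n"
proof -
  obtain P where P: "heis_odometer P" "seq_refines \<Gamma> P" "seq_refines P \<Gamma>" "\<And>n. xy_product_subgroup (P n)"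
    using assms conjugate_iff_refines[OF odo] unfolding xy_product_odometer_def by blast
  obtain k where k: "P k \<subseteq> \<Gamma> n"
    using P(3) unfolding seq_refines_def by blast
  obtain m where m: "\<Gamma> m \<subseteq> P k"
    using P(2) unfolding seq_refines_def by blast
  obtain a b where "\<And>x y. (\<exists>z. (x, y, z) \<in> P k) \<longleftrightarrow> a dvd x \<and> b dvd y"
    using P(4)[of k] unfolding xy_product_subgroup_iff by blast
  then show thesis
    using k m by (intro that[of m a b]) blast+
qed

text \<open>Heights are tied to \<open>x\<close> modulo \<open>2\<close>: the elements of \<open>twisted\<close> are the \<open>(x, y, z)\<close> with \<open>x\<close>
  and \<open>y\<close> even and \<open>z \<equiv> x / 2\<close> modulo \<open>2\<close>.\<close>

definition twisted :: "(int \<times> int \<times> int) set" where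
  "twisted = {(x, y, z). 2 dvd y \<and> 4 dvd x - 2 * z}"

definition skew :: "int \<Rightarrow> (int \<times> int \<times> int) set" where
  "skew q = {(x, y, z). q dvd x - y}"

lemma twisted_normal: "twisted \<lhd> heis"
proof (rule normal_heisI)
  have form: "\<exists>t u. x = 2 * z + 4 * t \<and> y = 2 * u" if "(x, y, z) \<in> twisted" for x y z
    using that by (auto simp: twisted_def dvd_def algebra_simps)
  show "(0, 0, 0) \<in> twisted"
    by (simp add: twisted_def)
  show "(x + x', y + y', z + z' + x * y') \<in> twisted"
    if prems: "(x, y, z) \<in> twisted" "(x', y', z') \<in> twisted" for x y z x' y' z'
  proof -
    obtain t u where "x = 2 * z + 4 * t" "y = 2 * u"
      using form[OF prems(1)] by blast
    moreover obtain t' u' where "x' = 2 * z' + 4 * t'" "y' = 2 * u'"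
      using form[OF prems(2)] by blast
    ultimately have "x + x' - 2 * (z + z' + x * y') = 4 * (t + t' - x * u')" "y + y' = 2 * (u + u')"
      by (simp_all add: algebra_simps)
    then show ?thesis
      by (simp add: twisted_def)
  qed
  show "(- x, - y, x * y - z) \<in> twisted" if prems: "(x, y, z) \<in> twisted" for x y z
  proof -
    obtain t u where "x = 2 * z + 4 * t" "y = 2 * u"
      using form[OF prems] by blast
    then have "- x - 2 * (x * y - z) = 4 * (- t - x * u)" "y = 2 * u"
      by (simp_all add: algebra_simps)
    then show ?thesis
      unfolding twisted_def by (simp only: mem_Collect_eq prod.case) simp
  qed
  show "(x, y, z + a * y - b * x) \<in> twisted" if prems: "(x, y, z) \<in> twisted" for x y z a b
  proof -
    obtain t u where "x = 2 * z + 4 * t" "y = 2 * u"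
      using form[OF prems] by blast
    then have "x - 2 * (z + a * y - b * x) = 4 * (t - a * u + b * (z + 2 * t))" "y = 2 * u"
      by (simp_all add: algebra_simps)
    then show ?thesis
      unfolding twisted_def by (simp only: mem_Collect_eq prod.case) simp
  qed
qed

lemma skew_normal: "skew q \<lhd> heis"
proof (rule normal_heisI)
  show "(x + x', y + y', z + z' + x * y') \<in> skew q"
    if "(x, y, z) \<in> skew q" "(x', y', z') \<in> skew q" for x y z x' y' z'
    using that dvd_add[of q "x - y" "x' - y'"] by (simp add: skew_def algebra_simps)
  show "(- x, - y, x * y - z) \<in> skew q" if "(x, y, z) \<in> skew q" for x y z
    using that dvd_minus_iff[of q "x - y"] by (simp add: skew_def algebra_simps)
qed (auto simp: skew_def)

lemma heis_cube_subset_twisted: "heis_cube 4 \<subseteq> twisted"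
proof
  fix p assume p: "p \<in> heis_cube 4"
  obtain x y z where xyz: "p = (x, y, z)"
    by (cases p)
  have "4 dvd x" "4 dvd y" "4 dvd z"
    using p unfolding xyz heis_cube_def by blast+
  then have "2 dvd y \<and> 4 dvd x - 2 * z"
    by presburger
  then show "p \<in> twisted"
    unfolding xyz twisted_def by blast
qed

lemma heis_cube_subset_skew:
  assumes "q dvd r"
  shows "heis_cube r \<subseteq> skew q"
proof
  fix p assume p: "p \<in> heis_cube r"
  obtain x y z where xyz: "p = (x, y, z)"
    by (cases p)
  have "r dvd x - y"
    using p unfolding xyz heis_cube_def by (blast intro: dvd_diff)
  with assms have "q dvd x - y"
    by (rule dvd_trans)
  then show "p \<in> skew q"
    unfolding xyz skew_def by blast
qed

lemma not_four_dvd_double_power_three: "\<not> 4 dvd 2 * (3::int) ^ n"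
proof -
  have "\<not> 4 dvd 2 * k" if "odd k" for k :: int
    using that by presburger
  then show ?thesis
    by simp
qed

lemma heis_odometer_UNIV: "heis_odometer (cube_odometer UNIV)"
  by (intro heis_odometer_cube normal_heisI) auto

lemma pure_product_UNIV: "pure_product_odometer (cube_odometer UNIV)"
proof (rule pure_product_odometer_if_flat_xy_product[OF heis_odometer_UNIV])
  have mem: "(x, y, z) \<in> cube_odometer UNIV n \<longleftrightarrow> 3 ^ n dvd x \<and> 3 ^ n dvd y \<and> 3 ^ n dvd z"
    for x y z n
    by (simp add: cube_odometer_def heis_cube_def)
  show "flat_odometer (cube_odometer UNIV)"
    by (rule flat_odometerI[OF heis_odometer_UNIV]) (simp add: mem)
  show "xy_product_odometer (cube_odometer UNIV)"
  proof (rule xy_product_odometerI[OF heis_odometer_UNIV, of "\<lambda>n. 3 ^ n" "\<lambda>n. 3 ^ n"])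
    show "(\<exists>z. (x, y, z) \<in> cube_odometer UNIV n) \<longleftrightarrow> 3 ^ n dvd x \<and> 3 ^ n dvd y" for n x y
      unfolding mem using dvd_0_right by blast
  qed simp_all
qed

lemma heis_odometer_twisted: "heis_odometer (cube_odometer twisted)"
  by (intro heis_odometer_cube twisted_normal heis_cube_subset_twisted)

lemma xy_product_twisted: "xy_product_odometer (cube_odometer twisted)"
proof (rule xy_product_odometerI[OF heis_odometer_twisted, of "\<lambda>n. 2 * 3 ^ n" "\<lambda>n. 2 * 3 ^ n"])
  fix n :: nat and x y :: int
  have coprime: "coprime (2::int) (3 ^ n)"
    by simp
  show "(\<exists>z. (x, y, z) \<in> cube_odometer twisted n) \<longleftrightarrow> 2 * 3 ^ n dvd x \<and> 2 * 3 ^ n dvd y"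
  proof
    assume "\<exists>z. (x, y, z) \<in> cube_odometer twisted n"
    then obtain z where z: "2 dvd y" "4 dvd x - 2 * z" "3 ^ n dvd x" "3 ^ n dvd y"
      by (auto simp: cube_odometer_def twisted_def heis_cube_def)
    from z(2) have "2 dvd x"
      by presburger
    with z coprime show "2 * 3 ^ n dvd x \<and> 2 * 3 ^ n dvd y"
      by (simp add: divides_mult)
  next
    assume xy: "2 * 3 ^ n dvd x \<and> 2 * 3 ^ n dvd y"
    then obtain u where u: "x = 2 * (3 ^ n * u)"
      by (auto simp: dvd_def)
    have "2 dvd y" "3 ^ n dvd y"
      using xy dvd_mult_left dvd_mult_right by blast+
    then have "(x, y, 3 ^ n * u) \<in> cube_odometer twisted n"
      using u by (simp add: cube_odometer_def twisted_def heis_cube_def)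
    then show "\<exists>z. (x, y, z) \<in> cube_odometer twisted n" ..
  qed
qed simp_all

text \<open>The witness is \<open>(2 * 3 ^ m, 0, 3 ^ m)\<close>: without its height it satisfies the congruence only
  if \<open>4\<close> divides \<open>2 * 3 ^ m\<close>.\<close>

lemma not_flat_twisted: "\<not> flat_odometer (cube_odometer twisted)"
proof
  assume "flat_odometer (cube_odometer twisted)"
  from flat_odometerD[OF heis_odometer_twisted this, of 0] obtain m where
    m: "\<And>x y z. (x, y, z) \<in> cube_odometer twisted m \<Longrightarrow> (x, y, 0) \<in> cube_odometer twisted 0"
    by blast
  have "(2 * 3 ^ m, 0, 3 ^ m) \<in> cube_odometer twisted m"
    by (simp add: cube_odometer_def twisted_def heis_cube_def)
  from m[OF this] show False
    using not_four_dvd_double_power_three[of m] by (simp add: cube_odometer_def twisted_def)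
qed

lemma heis_odometer_skew: "heis_odometer (cube_odometer (skew 2))"
  by (intro heis_odometer_cube skew_normal heis_cube_subset_skew) simp

lemma flat_skew: "flat_odometer (cube_odometer (skew 2))"
  by (rule flat_odometerI[OF heis_odometer_skew])
    (auto simp: cube_odometer_def heis_cube_def skew_def)

text \<open>A product lattice \<open>a\<int> \<times> b\<int>\<close> inside \<open>{(x, y). x \<equiv> y mod 2}\<close> contains \<open>(a, 0)\<close>, so \<open>a\<close> is
  even, whereas \<open>(3 ^ m, 3 ^ m)\<close> has odd coordinates.\<close>

lemma not_xy_product_skew: "\<not> xy_product_odometer (cube_odometer (skew 2))"
proof
  assume "xy_product_odometer (cube_odometer (skew 2))"
  from xy_product_odometerD[OF heis_odometer_skew this, of 0] obtain m a b where
    outer: "\<And>x y z. (x, y, z) \<in> cube_odometer (skew 2) m \<Longrightarrow> a dvd x \<and> b dvd y"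
    and inner: "\<And>x y. a dvd x \<Longrightarrow> b dvd y \<Longrightarrow> \<exists>z. (x, y, z) \<in> cube_odometer (skew 2) 0"
    by blast
  have "(3 ^ m, 3 ^ m, 0) \<in> cube_odometer (skew 2) m"
    by (simp add: cube_odometer_def skew_def heis_cube_def)
  from outer[OF this] have "a dvd 3 ^ m"
    by blast
  moreover have "2 dvd a"
    using inner[of a 0] by (auto simp: cube_odometer_def skew_def)
  ultimately have "2 dvd (3::int) ^ m"
    using dvd_trans by blast
  then show False
    by simp
qed

lemma heis_odometer_twisted_skew: "heis_odometer (cube_odometer (twisted \<inter> skew 4))"
  by (intro heis_odometer_cube heis.normal_subgroup_intersect twisted_normal skew_normal
      Int_greatest heis_cube_subset_twisted heis_cube_subset_skew) simp

text \<open>The obstructions used for \<open>twisted\<close> and \<open>skew 2\<close> act together. In \<open>twisted\<close> both \<open>x\<close>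
  and \<open>y\<close> are even, so the skewness is imposed modulo \<open>4\<close> and detected by \<open>(2 * 3 ^ m, 2 * 3 ^ m)\<close>.\<close>

lemma not_flat_twisted_skew: "\<not> flat_odometer (cube_odometer (twisted \<inter> skew 4))"
proof
  let ?\<Gamma> = "cube_odometer (twisted \<inter> skew 4)"
  assume "flat_odometer ?\<Gamma>"
  from flat_odometerD[OF heis_odometer_twisted_skew this, of 0] obtain m where
    m: "\<And>x y z. (x, y, z) \<in> ?\<Gamma> m \<Longrightarrow> (x, y, 0) \<in> ?\<Gamma> 0"
    by blast
  have "(2 * 3 ^ m, 2 * 3 ^ m, 3 ^ m) \<in> ?\<Gamma> m"
    by (simp add: cube_odometer_def twisted_def skew_def heis_cube_def)
  from m[OF this] show False
    using not_four_dvd_double_power_three[of m] by (simp add: cube_odometer_def twisted_def)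
qed

lemma not_xy_product_twisted_skew: "\<not> xy_product_odometer (cube_odometer (twisted \<inter> skew 4))"
proof
  let ?\<Gamma> = "cube_odometer (twisted \<inter> skew 4)"
  assume "xy_product_odometer ?\<Gamma>"
  from xy_product_odometerD[OF heis_odometer_twisted_skew this, of 0] obtain m a b where
    outer: "\<And>x y z. (x, y, z) \<in> ?\<Gamma> m \<Longrightarrow> a dvd x \<and> b dvd y"
    and inner: "\<And>x y. a dvd x \<Longrightarrow> b dvd y \<Longrightarrow> \<exists>z. (x, y, z) \<in> ?\<Gamma> 0"
    by blast
  have "(2 * 3 ^ m, 2 * 3 ^ m, 3 ^ m) \<in> ?\<Gamma> m"
    by (simp add: cube_odometer_def twisted_def skew_def heis_cube_def)
  from outer[OF this] have "a dvd 2 * 3 ^ m"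
    by blast
  moreover have "4 dvd a"
    using inner[of a 0] by (auto simp: cube_odometer_def skew_def)
  ultimately show False
    using not_four_dvd_double_power_three[of m] dvd_trans by blast
qed

section \<open>The classification\<close>

theorem theorem4p3:
  shows "(\<forall>\<Gamma>. heis_odometer \<Gamma> \<longrightarrow>
           pure_product_odometer \<Gamma> \<or>
           (xy_product_odometer \<Gamma> \<and> \<not> flat_odometer \<Gamma>) \<or>
           (flat_odometer \<Gamma> \<and> \<not> xy_product_odometer \<Gamma>) \<or>
           (\<not> flat_odometer \<Gamma> \<and> \<not> xy_product_odometer \<Gamma>)) \<and>
         (\<exists>\<Gamma>. heis_odometer \<Gamma> \<and> pure_product_odometer \<Gamma>) \<and>
         (\<exists>\<Gamma>. heis_odometer \<Gamma> \<and> xy_product_odometer \<Gamma> \<and> \<not> flat_odometer \<Gamma>) \<and>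
         (\<exists>\<Gamma>. heis_odometer \<Gamma> \<and> flat_odometer \<Gamma> \<and> \<not> xy_product_odometer \<Gamma>) \<and>
         (\<exists>\<Gamma>. heis_odometer \<Gamma> \<and> \<not> flat_odometer \<Gamma> \<and> \<not> xy_product_odometer \<Gamma>)"
  using pure_product_odometer_if_flat_xy_product heis_odometer_UNIV pure_product_UNIV
    heis_odometer_twisted xy_product_twisted not_flat_twisted
    heis_odometer_skew flat_skew not_xy_product_skew
    heis_odometer_twisted_skew not_flat_twisted_skew not_xy_product_twisted_skew
  by blast

end
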